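(* There exist two non-isomorphic non-finitely generated atomic Puiseux monoids $M$ and $M'$ with the same system of sets of lengths, i.e. with $\mathcal{L}(M) = \mathcal{L}(M')$.
   Context: A Puiseux monoid is an additive submonoid of $\mathbb{Q}_{\ge 0}$ (containing $0$). It is non-finitely generated if no finite set generates it as a monoid. An atom of a Puiseux monoid $M$ is a nonzero element $a \in M$ such that $a = u+v$ with $u,v \in M$ implies $u = 0$ or $v = 0$; $\mathcal{A}(M)$ is the set of atoms, and $M$ is atomic if $\mathcal{A}(M)$ generates $M$. A factorization of $x \in M$ is a formal (unordered) sum $a_1 + \dots + a_n$ of atoms, i.e. an element of the free commutative monoid on $\mathcal{A}(M)$, whose value in $M$ is $x$; its length is $n$ (the empty sum, of length $0$, is the only factorization of $0$). The set of lengths $\mathsf{L}(x)$ is the set of all lengths of factorizations of $x$, and $\mathcal{L}(M) = \{\mathsf{L}(x) \mid x \in M\}$ is the system of sets of lengths of $M$. Isomorphism means isomorphism of monoids. *)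

theory Defs
  imports Complex_Main "HOL-Library.Multiset" "HOL-Algebra.Group"
begin

definition nonneg_rat :: "rat monoid" where
  "nonneg_rat = \<lparr>carrier = {0..}, monoid.mult = (+), one = 0\<rparr>"

definition puiseux_monoid :: "rat set \<Rightarrow> bool" where
  "puiseux_monoid M \<longleftrightarrow> submonoid M nonneg_rat"

definition generated_submonoid :: "rat set \<Rightarrow> rat set" where
  "generated_submonoid A = (\<lambda>N. submonoid N nonneg_rat) hull A"

definition finitely_generated :: "rat set \<Rightarrow> bool" where
  "finitely_generated M \<longleftrightarrow> (\<exists>A. finite A \<and> A \<subseteq> M \<and> generated_submonoid A = M)"

definition atoms :: "rat set \<Rightarrow> rat set" where
  "atoms M = {a \<in> M. a \<noteq> 0 \<and> (\<forall>u\<in>M. \<forall>v\<in>M. a = u + v \<longrightarrow> u = 0 \<or> v = 0)}"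

definition atomic :: "rat set \<Rightarrow> bool" where
  "atomic M \<longleftrightarrow> generated_submonoid (atoms M) = M"

text \<open>The free commutative monoid on the atoms is rendered as the finite multisets of atoms.\<close>

definition factorizations :: "rat set \<Rightarrow> rat \<Rightarrow> rat multiset set" where
  "factorizations M x = {F. set_mset F \<subseteq> atoms M \<and> \<Sum>\<^sub># F = x}"

definition set_of_lengths :: "rat set \<Rightarrow> rat \<Rightarrow> nat set" where
  "set_of_lengths M x = size ` factorizations M x"

definition system_of_sets_of_lengths :: "rat set \<Rightarrow> nat set set" where
  "system_of_sets_of_lengths M = set_of_lengths M ` M"

text \<open>\<open>iso\<close> does not demand that the unit be preserved; for a bijective
  homomorphism between monoids this is automatic.\<close>

definition isomorphic :: "rat set \<Rightarrow> rat set \<Rightarrow> bool" where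
  "isomorphic M M' \<longleftrightarrow> nonneg_rat\<lparr>carrier := M\<rparr> \<cong> nonneg_rat\<lparr>carrier := M'\<rparr>"

end

theory Submission
  imports Defs "HOL-Computational_Algebra.Primes"
begin

text \<open>
  For an infinite set \<open>D\<close> of odd primes with \<open>3 \<in> D\<close>, let \<open>M\<close> be generated by \<open>1\<close> and the numbers
  \<open>1 - 1/p\<close> with \<open>p \<in> D\<close>.  All generators lie in \<open>[2/3, 1]\<close>, so they are atoms.  The only relations
  exchange \<open>p\<close> copies of \<open>1 - 1/p\<close> for \<open>p - 1\<close> copies of \<open>1\<close>, each changing the length by one, and the
  cheapest in terms of copies of \<open>1\<close> is the one for \<open>p = 3\<close>.  Therefore the sets of lengths are exactly
  the intervals \<open>{n..n + m}\<close> with \<open>2 m \<le> n\<close>, whatever \<open>D\<close> is.  On the other hand an isomorphism is the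
  multiplication by a positive rational, which must fix the largest atom \<open>1\<close>, so the monoid
  determines \<open>D\<close>.
\<close>

section \<open>Submonoids generated by a set, and their atoms\<close>

lemma submonoid_nonneg_rat_iff:
  "submonoid M nonneg_rat \<longleftrightarrow> M \<subseteq> {0..} \<and> 0 \<in> M \<and> (\<forall>u\<in>M. \<forall>v\<in>M. u + v \<in> M)"
  by (auto simp: submonoid_def nonneg_rat_def)

lemma submonoid_sum_mset:
  assumes "submonoid M nonneg_rat" "set_mset F \<subseteq> M"
  shows "\<Sum>\<^sub># F \<in> M"
  using assms(2)
proof (induction F)
  case empty
  then show ?case using assms(1) by (simp add: submonoid_nonneg_rat_iff)
next
  case (add a F)
  then show ?case using assms(1) by (simp add: submonoid_nonneg_rat_iff)
qed

lemma submonoid_sums: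
  assumes "A \<subseteq> {0..}"
  shows "submonoid {\<Sum>\<^sub># F |F. set_mset F \<subseteq> A} nonneg_rat"
  unfolding submonoid_nonneg_rat_iff
proof (intro conjI ballI)
  show "{\<Sum>\<^sub># F |F. set_mset F \<subseteq> A} \<subseteq> {0..}"
    using assms submonoid_sum_mset[of "{0..}"] by (auto simp: submonoid_nonneg_rat_iff)
  show "0 \<in> {\<Sum>\<^sub># F |F. set_mset F \<subseteq> A}"
    by (rule CollectI, rule exI[of _ "{#}"]) simp
next
  fix u v assume "u \<in> {\<Sum>\<^sub># F |F. set_mset F \<subseteq> A}" "v \<in> {\<Sum>\<^sub># F |F. set_mset F \<subseteq> A}"
  then obtain F G where "u = \<Sum>\<^sub># F" "set_mset F \<subseteq> A" "v = \<Sum>\<^sub># G" "set_mset G \<subseteq> A"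
    by blast
  then show "u + v \<in> {\<Sum>\<^sub># F |F. set_mset F \<subseteq> A}"
    by (intro CollectI exI[of _ "F + G"]) simp
qed

lemma generated_submonoid_eq_sums:
  assumes "A \<subseteq> {0..}"
  shows "generated_submonoid A = {\<Sum>\<^sub># F |F. set_mset F \<subseteq> A}"
  unfolding generated_submonoid_def
proof (rule hull_unique)
  show "A \<subseteq> {\<Sum>\<^sub># F |F. set_mset F \<subseteq> A}"
  proof
    fix a assume "a \<in> A"
    then show "a \<in> {\<Sum>\<^sub># F |F. set_mset F \<subseteq> A}"
      by (intro CollectI exI[of _ "{#a#}"]) simp
  qed
  show "submonoid {\<Sum>\<^sub># F |F. set_mset F \<subseteq> A} nonneg_rat"
    using assms by (rule submonoid_sums)
  show "{\<Sum>\<^sub># F |F. set_mset F \<subseteq> A} \<subseteq> N" if "A \<subseteq> N" "submonoid N nonneg_rat" for N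
    using that submonoid_sum_mset by blast
qed

text \<open>Deleting an atom \<open>a\<close> from \<open>M\<close> leaves a submonoid, because a
  sum equal to \<open>a\<close> has \<open>a\<close> itself as a summand. A generating set that
  missed \<open>a\<close> would therefore stay inside \<open>M - {a}\<close>.\<close>

lemma atoms_subset_generators:
  assumes "puiseux_monoid M" "B \<subseteq> M" "generated_submonoid B = M"
  shows "atoms M \<subseteq> B"
proof
  fix a assume a: "a \<in> atoms M"
  show "a \<in> B"
  proof (rule ccontr)
    assume "a \<notin> B"
    moreover have "submonoid (M - {a}) nonneg_rat"
      using assms(1) a unfolding puiseux_monoid_def submonoid_nonneg_rat_iff atoms_def
      by auto (metis add.left_neutral add.right_neutral)
    ultimately have "generated_submonoid B \<subseteq> M - {a}"
      using assms(2) unfolding generated_submonoid_def by (intro hull_minimal) auto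
    then show False using a assms(3) by (auto simp: atoms_def)
  qed
qed

lemma finitely_generated_imp_finite_atoms:
  assumes "puiseux_monoid M" "finitely_generated M"
  shows "finite (atoms M)"
proof -
  from assms(2) obtain B where "finite B" "B \<subseteq> M" "generated_submonoid B = M"
    unfolding finitely_generated_def by blast
  then show ?thesis using atoms_subset_generators[OF assms(1)] finite_subset by metis
qed

section \<open>Isomorphisms of Puiseux monoids as scalings\<close>

text \<open>For \<open>x = m / n\<close> the relation \<open>n * x = m * 1\<close> holds inside
  \<open>M\<close>, so additivity gives \<open>n * f x = m * f 1\<close>: the value of
  \<open>f\<close> at 1 determines \<open>f\<close> and is the scaling factor.\<close>

lemma isomorphic_imp_scaling:
  assumes M: "puiseux_monoid M" and M': "puiseux_monoid M'" and iso: "isomorphic M M'"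
    and one: "1 \<in> M"
  obtains q where "q > 0" "M' = (*) q ` M"
proof -
  from iso obtain f where
    bij: "bij_betw f M M'" and add: "\<And>x y. x \<in> M \<Longrightarrow> y \<in> M \<Longrightarrow> f (x + y) = f x + f y"
    by (auto simp: isomorphic_def is_iso_def iso_def hom_def nonneg_rat_def)
  have zero: "0 \<in> M" and closed: "\<And>x y. x \<in> M \<Longrightarrow> y \<in> M \<Longrightarrow> x + y \<in> M"
    and pos: "\<And>x. x \<in> M \<Longrightarrow> x \<ge> 0"
    using M by (auto simp: puiseux_monoid_def submonoid_nonneg_rat_iff)
  have f0: "f 0 = 0" using add[OF zero zero] by simp
  have mult: "of_nat n * x \<in> M \<and> f (of_nat n * x) = of_nat n * f x" if "x \<in> M" for n x
    using that by (induction n) (auto simp: zero f0 closed add algebra_simps)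
  have scale: "f x = f 1 * x" if x: "x \<in> M" for x
  proof -
    obtain a b :: int where ab: "x = of_int a / of_int b" "b > 0"
      by (cases x) (auto simp: Fract_of_int_quotient)
    then have "a \<ge> 0" using pos[OF x] by (simp add: zero_le_divide_iff)
    then obtain m n where mn: "a = int m" "b = int n" using ab(2) by (metis nonneg_int_cases less_imp_le)
    have m: "of_nat m * 1 = of_nat n * x" using ab mn by simp
    then have "of_nat n * f x = of_nat m * f 1" using mult[OF x, of n] mult[OF one, of m] by simp
    also have "\<dots> = of_nat n * (f 1 * x)" using m by simp
    finally show ?thesis using ab(2) mn(2) by simp
  qed
  have "f ` M = (*) (f 1) ` M" by (rule image_cong[OF refl scale])
  then have img: "M' = (*) (f 1) ` M" using bij_betw_imp_surj_on[OF bij] by simp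
  have "f 1 \<noteq> f 0" using inj_on_eq_iff[OF bij_betw_imp_inj_on[OF bij] one zero] by simp
  moreover have "f 1 \<ge> 0"
    using bij one M' by (auto simp: bij_betw_def puiseux_monoid_def submonoid_nonneg_rat_iff)
  ultimately have "f 1 > 0" using f0 by simp
  with img show thesis by (rule that[rotated])
qed

lemma atoms_scaling:
  assumes "q \<noteq> 0"
  shows "atoms ((*) q ` M) = (*) q ` atoms M"
proof -
  have "q * x = q * u + q * v \<longleftrightarrow> x = u + v" for x u v
    using assms by (simp flip: distrib_left)
  then show ?thesis using assms unfolding atoms_def by auto
qed

section \<open>Integrality at a prime and the numbers 1 - 1/p\<close>

text \<open>For prime \<open>p\<close> this is the localization of the integers at \<open>p\<close>.
  The denominator 0 is excluded because \<open>p dvd 0\<close>.\<close>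

definition prime_integral :: "nat \<Rightarrow> rat set" where
  "prime_integral p = {of_int a / of_nat b |a b. \<not> p dvd b}"

lemma prime_integral_add:
  assumes p: "prime p" and "x \<in> prime_integral p" "y \<in> prime_integral p"
  shows "x + y \<in> prime_integral p"
proof -
  obtain a b c d where *: "x = of_int a / of_nat b" "\<not> p dvd b" "y = of_int c / of_nat d" "\<not> p dvd d"
    using assms by (auto simp: prime_integral_def)
  then have "b \<noteq> 0" "d \<noteq> 0" by (auto intro: ccontr)
  then have "x + y = of_int (a * int d + c * int b) / of_nat (b * d)"
    using * by (simp add: field_simps)
  moreover have "\<not> p dvd b * d" using * p by (simp add: prime_dvd_mult_iff)
  ultimately show ?thesis unfolding prime_integral_def by blast
qed

lemma prime_integral_uminus: "x \<in> prime_integral p \<Longrightarrow> - x \<in> prime_integral p"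
  unfolding prime_integral_def by clarsimp (metis minus_divide_left of_int_minus)

lemma of_int_prime_integral: "prime p \<Longrightarrow> of_int a \<in> prime_integral p"
  unfolding prime_integral_def by (rule CollectI, rule exI[of _ a], rule exI[of _ 1]) auto

definition prime_atom :: "nat \<Rightarrow> rat" where
  "prime_atom p = 1 - 1 / of_nat p"

lemma prime_atom_lt_1: "p > 0 \<Longrightarrow> prime_atom p < 1"
  by (simp add: prime_atom_def)

lemma prime_atom_ge: "p \<ge> 3 \<Longrightarrow> prime_atom p \<ge> 2 / 3"
proof -
  assume "p \<ge> 3"
  then have "1 / (of_nat p :: rat) \<le> 1 / 3"
    by (intro divide_left_mono) (auto simp: of_nat_le_iff[of 3, simplified])
  then show ?thesis by (simp add: prime_atom_def)
qed

lemma prime_atom_eq_iff [simp]: "prime_atom p = prime_atom q \<longleftrightarrow> p = q"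
  by (simp add: prime_atom_def)

lemma of_nat_mult_prime_atom: "p > 0 \<Longrightarrow> of_nat p * prime_atom p = of_nat (p - 1)"
  by (simp add: prime_atom_def algebra_simps of_nat_diff)

lemma prime_atom_prime_integral:
  assumes "prime p" "prime q" "q \<noteq> p"
  shows "prime_atom q \<in> prime_integral p"
proof -
  have "q > 0" using assms prime_gt_0_nat by blast
  then have "prime_atom q = of_int (int q - 1) / of_nat q"
    by (simp add: prime_atom_def field_simps)
  moreover have "\<not> p dvd q" using assms primes_dvd_imp_eq by blast
  ultimately show ?thesis unfolding prime_integral_def by blast
qed

text \<open>In \<open>prime_atom p = (p - 1) / p\<close> the prime \<open>p\<close> does not cancel,
  so only the factor \<open>c\<close> can remove it from the denominator.\<close>

lemma prime_dvd_of_mult_prime_atom_integral: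
  assumes p: "prime p" and "of_int c * prime_atom p \<in> prime_integral p"
  shows "int p dvd c"
proof -
  obtain a b where ab: "of_int c * prime_atom p = of_int a / of_nat b" "\<not> p dvd b"
    using assms by (auto simp: prime_integral_def)
  have "b > 0" "p > 0" using ab p prime_gt_0_nat by (auto intro: Nat.gr0I)
  then have "(of_int (c * (int p - 1) * int b) :: rat) = of_int (a * int p)"
    using ab(1) by (simp add: prime_atom_def field_simps)
  then have "c * (int p - 1) * int b = a * int p" by (simp only: of_int_eq_iff)
  then have "int p dvd c * (int p - 1) * int b" by simp
  moreover have "\<not> int p dvd int p - 1"
    using p by (metis dvd_diff_right_iff dvd_refl not_prime_unit prime_nat_int_transfer)
  ultimately show ?thesis
    using p ab(2) by (auto simp: prime_dvd_mult_iff)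
qed

section \<open>The monoid attached to a set of odd primes\<close>

text \<open>Infinitude of \<open>D\<close> serves twice: it rules out finite generation, and it
  supplies arbitrarily many distinct atoms other than 1 when prescribed intervals are realized as
  sets of lengths.\<close>

locale prime_atom_monoid =
  fixes D :: "nat set"
  assumes prime_D: "p \<in> D \<Longrightarrow> prime p"
    and ge_3: "p \<in> D \<Longrightarrow> p \<ge> 3"
    and infinite_D: "infinite D"
    and three_in_D: "3 \<in> D"
begin

definition gens :: "rat set" where "gens = insert 1 (prime_atom ` D)"

definition M :: "rat set" where "M = {\<Sum>\<^sub># F |F. set_mset F \<subseteq> gens}"

lemma one_in_gens: "1 \<in> gens"
  by (simp add: gens_def)

lemma prime_atom_in_gens: "p \<in> D \<Longrightarrow> prime_atom p \<in> gens"
  by (simp add: gens_def)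

lemma gens_le_1: "a \<in> gens \<Longrightarrow> a \<le> 1"
  by (auto simp: gens_def prime_atom_def)

lemma gens_ge: "a \<in> gens \<Longrightarrow> a \<ge> 2 / 3"
  using prime_atom_ge ge_3 by (auto simp: gens_def)

lemma prime_atom_neq_1: "p \<in> D \<Longrightarrow> prime_atom p \<noteq> 1" "p \<in> D \<Longrightarrow> 1 \<noteq> prime_atom p"
  using prime_atom_lt_1[of p] ge_3[of p] by auto

lemma gens_nonneg: "gens \<subseteq> {0..}"
proof
  fix a assume "a \<in> gens"
  then show "a \<in> {0..}" using gens_ge[of a] by simp
qed

lemma puiseux_monoid_M: "puiseux_monoid M"
  unfolding puiseux_monoid_def M_def by (rule submonoid_sums) (rule gens_nonneg)

lemma gens_subset_M: "gens \<subseteq> M"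
proof
  fix a assume "a \<in> gens"
  then show "a \<in> M" unfolding M_def by (intro CollectI exI[of _ "{#a#}"]) simp
qed

lemma sum_mset_gens_ge: "set_mset F \<subseteq> gens \<Longrightarrow> \<Sum>\<^sub># F \<ge> of_nat (size F) * (2 / 3)"
proof (induction F)
  case (add a F)
  then have "a \<ge> 2 / 3" "\<Sum>\<^sub># F \<ge> of_nat (size F) * (2 / 3)" using gens_ge by auto
  then show ?case by (simp add: algebra_simps)
qed simp

lemma M_ge: "u \<in> M \<Longrightarrow> u \<noteq> 0 \<Longrightarrow> u \<ge> 2 / 3"
proof -
  assume "u \<in> M" "u \<noteq> 0"
  then obtain F where F: "u = \<Sum>\<^sub># F" "set_mset F \<subseteq> gens" by (auto simp: M_def)
  with \<open>u \<noteq> 0\<close> have "F \<noteq> {#}" by auto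
  then have "size F \<ge> 1" by (simp add: Suc_le_eq nonempty_has_size)
  then have "(of_nat (size F) :: rat) \<ge> 1" by simp
  with sum_mset_gens_ge[OF F(2)] F(1) show ?thesis by linarith
qed

text \<open>Two nonzero elements add up to at least 4/3, more than any generator. Conversely,
  splitting one generator off an atom must leave the remainder 0.\<close>

lemma atoms_M: "atoms M = gens"
proof
  show "gens \<subseteq> atoms M"
  proof
    fix a assume a: "a \<in> gens"
    have "u = 0 \<or> v = 0" if "u \<in> M" "v \<in> M" "a = u + v" for u v
      using M_ge[OF that(1)] M_ge[OF that(2)] gens_le_1[OF a] that(3) by fastforce
    then show "a \<in> atoms M" using a gens_subset_M gens_ge[OF a] by (auto simp: atoms_def)
  qed
  show "atoms M \<subseteq> gens"
  proof
    fix x assume x: "x \<in> atoms M"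
    then obtain F where F: "x = \<Sum>\<^sub># F" "set_mset F \<subseteq> gens" by (auto simp: atoms_def M_def)
    with x obtain a G where G: "F = add_mset a G" by (cases F) (auto simp: atoms_def)
    have "a \<in> M" "\<Sum>\<^sub># G \<in> M" "a \<noteq> 0" "a \<in> gens"
      using F G gens_subset_M gens_ge[of a] by (auto simp: M_def)
    then have "\<Sum>\<^sub># G = 0" using x F(1) G by (auto simp: atoms_def)
    then show "x \<in> gens" using F G by simp
  qed
qed

lemma atomic_M: "atomic M"
  unfolding atomic_def atoms_M generated_submonoid_eq_sums[OF gens_nonneg] by (simp add: M_def)

lemma not_finitely_generated_M: "\<not> finitely_generated M"
proof
  assume "finitely_generated M"
  then have "finite gens"
    using finitely_generated_imp_finite_atoms[OF puiseux_monoid_M] by (simp add: atoms_M)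
  then have "finite (prime_atom ` D)" by (simp add: gens_def)
  then show False using infinite_D by (auto dest: finite_imageD simp: inj_on_def)
qed

section \<open>Normal forms and sets of lengths\<close>

text \<open>These are the factorizations to which no exchange of \<open>p\<close> copies of
  \<open>prime_atom p\<close> for \<open>p - 1\<close> copies of 1 applies.\<close>

definition normal :: "rat multiset \<Rightarrow> bool" where
  "normal F \<longleftrightarrow> set_mset F \<subseteq> gens \<and> (\<forall>p\<in>D. count F (prime_atom p) < p)"

lemma sum_mset_minus_count_integral:
  assumes p: "p \<in> D" and "set_mset F \<subseteq> gens"
  shows "\<Sum>\<^sub># F - of_nat (count F (prime_atom p)) * prime_atom p \<in> prime_integral p"
  using assms(2)
proof (induction F)
  case empty
  then show ?case using of_int_prime_integral[OF prime_D[OF p], of 0] by simp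
next
  case (add a F)
  show ?case
  proof (cases "a = prime_atom p")
    case True
    then show ?thesis using add by (simp add: algebra_simps)
  next
    case False
    then have "a \<in> prime_integral p"
      using add.prems of_int_prime_integral[OF prime_D[OF p], of 1]
        prime_atom_prime_integral[OF prime_D[OF p] prime_D] by (auto simp: gens_def)
    then have "a + (\<Sum>\<^sub># F - of_nat (count F (prime_atom p)) * prime_atom p) \<in> prime_integral p"
      using add prime_D[OF p] by (intro prime_integral_add) auto
    then show ?thesis using False by (simp add: add_diff_eq)
  qed
qed

text \<open>Comparing two equal sums modulo \<open>prime_integral p\<close> fixes the multiplicity
  of \<open>prime_atom p\<close> modulo \<open>p\<close>, hence exactly, by normality. The number of
  copies of 1 is then forced by the common value.\<close>

lemma normal_unique:
  assumes F: "normal F" and G: "normal G" and eq: "\<Sum>\<^sub># F = \<Sum>\<^sub># G"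
  shows "F = G"
proof -
  have cnt: "count F (prime_atom p) = count G (prime_atom p)" if p: "p \<in> D" for p
  proof -
    define c where "c = int (count F (prime_atom p)) - int (count G (prime_atom p))"
    \<comment> \<open>The equal sums cancel in this difference, which leaves
      \<open>c * prime_atom p\<close>.\<close>
    have "(\<Sum>\<^sub># G - of_nat (count G (prime_atom p)) * prime_atom p)
        + - (\<Sum>\<^sub># F - of_nat (count F (prime_atom p)) * prime_atom p) \<in> prime_integral p"
      using F G p prime_D
      by (intro prime_integral_add prime_integral_uminus sum_mset_minus_count_integral)
        (auto simp: normal_def)
    then have "of_int c * prime_atom p \<in> prime_integral p"
      using eq by (simp add: c_def algebra_simps)
    then have "int p dvd c" by (rule prime_dvd_of_mult_prime_atom_integral[OF prime_D[OF p]])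
    moreover have "\<bar>c\<bar> < int p" using F G p unfolding normal_def c_def by force
    ultimately have "c = 0" using zdvd_not_zless[of "\<bar>c\<bar>" "int p"] by fastforce
    then show ?thesis by (simp add: c_def)
  qed
  let ?H = "filter_mset (\<lambda>a. a \<noteq> 1)"
  have "?H F = ?H G"
  proof (rule multiset_eqI)
    fix a
    consider "a = 1" | "a \<notin> gens" | p where "p \<in> D" "a = prime_atom p" by (auto simp: gens_def)
    then show "count (?H F) a = count (?H G) a"
    proof cases
      case 2
      then have "a \<notin># F" "a \<notin># G" using F G by (auto simp: normal_def)
      then show ?thesis by (simp add: not_in_iff)
    qed (simp_all add: cnt)
  qed
  moreover have split: "X = replicate_mset (count X 1) 1 + ?H X" for X :: "rat multiset"
    using multiset_partition[of X "\<lambda>a. a = 1"] by (simp add: filter_eq_replicate_mset)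
  moreover have "\<Sum>\<^sub># X = of_nat (count X 1) + \<Sum>\<^sub># (?H X)" for X :: "rat multiset"
    by (subst split) simp
  ultimately show ?thesis using eq by (metis add_right_imp_eq of_nat_eq_iff)
qed

text \<open>Each exchange shortens \<open>G\<close> by one, so the process stops, and it creates
  \<open>p - 1\<close>, hence at least 2, copies of 1. Thus \<open>2 * size + count 1\<close> never
  decreases, which bounds the length of \<open>G\<close> in terms of its normal form.\<close>

lemma normalize:
  assumes "set_mset G \<subseteq> gens"
  shows "\<exists>F. normal F \<and> \<Sum>\<^sub># F = \<Sum>\<^sub># G \<and> size F \<le> size G \<and>
    2 * size G + count G 1 \<le> 2 * size F + count F 1"
  using assms
proof (induction "size G" arbitrary: G rule: less_induct)
  case less
  show ?case
  proof (cases "normal G")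
    case False
    then obtain p where p: "p \<in> D" "p \<le> count G (prime_atom p)"
      using less.prems by (auto simp: normal_def not_less)
    then obtain H where H: "G = replicate_mset p (prime_atom p) + H"
      by (metis count_le_replicate_mset_subset_eq subset_mset.le_iff_add)
    define G' where "G' = replicate_mset (p - 1) 1 + H"
    have p3: "p \<ge> 3" using ge_3 p by blast
    have "\<Sum>\<^sub># G' = \<Sum>\<^sub># G"
      using of_nat_mult_prime_atom[of p] p3 by (simp add: G'_def H)
    moreover have size: "size G = Suc (size G')" using p3 by (simp add: G'_def H)
    moreover have "count G' 1 = p - 1 + count G 1"
      using prime_atom_neq_1[OF p(1)] by (simp add: G'_def H)
    moreover have "set_mset G' \<subseteq> gens"
      using less.prems one_in_gens by (auto simp: G'_def H)
    moreover note less.hyps[of G']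
    ultimately obtain F where "normal F" "\<Sum>\<^sub># F = \<Sum>\<^sub># G" "size F \<le> size G'"
        "2 * size G' + (p - 1 + count G 1) \<le> 2 * size F + count F 1"
      by auto
    then show ?thesis using size p3 by (intro exI[of _ F]) auto
  qed auto
qed

text \<open>All factorizations of an element share one normal form, so \<open>normalize\<close>
  bounds every length from both sides. Reversing the exchange for the prime 3 reaches all lengths in
  between.\<close>

lemma set_of_lengths_normal:
  assumes F: "normal F"
  shows "set_of_lengths M (\<Sum>\<^sub># F) = {size F..size F + count F 1 div 2}"
proof (intro equalityI subsetI)
  fix n assume "n \<in> set_of_lengths M (\<Sum>\<^sub># F)"
  then obtain G where G: "set_mset G \<subseteq> gens" "\<Sum>\<^sub># G = \<Sum>\<^sub># F" "n = size G"
    by (auto simp: set_of_lengths_def factorizations_def atoms_M)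
  from normalize[OF G(1)] obtain F' where F': "normal F'" "\<Sum>\<^sub># F' = \<Sum>\<^sub># G" "size F' \<le> size G"
    "2 * size G + count G 1 \<le> 2 * size F' + count F' 1" by blast
  then have "F' = F" using F G normal_unique by simp
  then show "n \<in> {size F..size F + count F 1 div 2}" using F' G by auto
next
  fix n assume n: "n \<in> {size F..size F + count F 1 div 2}"
  define j where "j = n - size F"
  have "2 * j \<le> count F 1" using n by (auto simp: j_def)
  then obtain H where H: "F = replicate_mset (2 * j) 1 + H"
    by (metis count_le_replicate_mset_subset_eq subset_mset.le_iff_add)
  \<comment> \<open>As \<open>prime_atom 3\<close> is 2/3, the value \<open>2 * j\<close> is kept
    while the length grows by \<open>j\<close>.\<close>
  define G where "G = replicate_mset (3 * j) (prime_atom 3) + H"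
  have "set_mset G \<subseteq> gens"
    using F prime_atom_in_gens[OF three_in_D] by (auto simp: G_def H normal_def split: if_splits)
  moreover have "\<Sum>\<^sub># G = \<Sum>\<^sub># F" by (simp add: G_def H prime_atom_def)
  ultimately have "G \<in> factorizations M (\<Sum>\<^sub># F)"
    by (simp add: factorizations_def atoms_M)
  moreover have "size G = size F + j" by (simp add: G_def H)
  then have "n = size G" using n by (simp add: j_def)
  ultimately show "n \<in> set_of_lengths M (\<Sum>\<^sub># F)"
    unfolding set_of_lengths_def by (rule rev_image_eqI)
qed

lemma system_of_sets_of_lengths_M:
  "system_of_sets_of_lengths M = {{n..n + m} |n m :: nat. 2 * m \<le> n}"
proof (intro equalityI subsetI)
  fix L assume "L \<in> system_of_sets_of_lengths M"
  then obtain G where G: "set_mset G \<subseteq> gens" "L = set_of_lengths M (\<Sum>\<^sub># G)"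
    by (auto simp: system_of_sets_of_lengths_def M_def)
  from normalize[OF G(1)] obtain F where F: "normal F" "\<Sum>\<^sub># F = \<Sum>\<^sub># G" by blast
  have "L = {size F..size F + count F 1 div 2}" using set_of_lengths_normal[OF F(1)] F G by simp
  moreover have "2 * (count F 1 div 2) \<le> size F" using count_le_size[of F 1] by linarith
  ultimately show "L \<in> {{n..n + m} |n m :: nat. 2 * m \<le> n}" by blast
next
  fix L assume "L \<in> {{n..n + m} |n m :: nat. 2 * m \<le> n}"
  then obtain n m where L: "L = {n..n + m}" and nm: "2 * m \<le> (n::nat)" by blast
  \<comment> \<open>Distinct primes pad the length from \<open>2 * m\<close> to \<open>n\<close>:
    each atom they contribute occurs only once, so the form stays normal and the copies of 1 still
    number \<open>2 * m\<close>.\<close>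
  obtain E where E: "E \<subseteq> D" "finite E" "card E = n - 2 * m"
    using infinite_arbitrarily_large[OF infinite_D] by blast
  define F where "F = replicate_mset (2 * m) 1 + mset_set (prime_atom ` E)"
  have cnt1: "count F 1 = 2 * m"
    using E prime_atom_neq_1(2) by (auto simp: F_def count_mset_set')
  have size: "size F = n"
    using E nm by (simp add: F_def card_image inj_on_def)
  have "count F (prime_atom p) < p" if "p \<in> D" for p
    using ge_3[OF that] prime_atom_neq_1[OF that] by (simp add: F_def count_mset_set')
  moreover have "set_mset F \<subseteq> gens"
    using E one_in_gens prime_atom_in_gens by (auto simp: F_def split: if_splits)
  ultimately have "normal F" by (simp add: normal_def)
  then have "L = set_of_lengths M (\<Sum>\<^sub># F)" "\<Sum>\<^sub># F \<in> M"
    using set_of_lengths_normal[of F] cnt1 size L by (auto simp: M_def normal_def)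
  then show "L \<in> system_of_sets_of_lengths M" by (auto simp: system_of_sets_of_lengths_def)
qed

end

section \<open>Recovering the primes from the monoid\<close>

text \<open>A scaling maps atoms onto atoms. Both sets of atoms have maximum 1, so the factor is 1,
  and the atoms below 1 then give back the primes.\<close>

lemma prime_atom_monoid_isomorphic_imp_eq:
  assumes "prime_atom_monoid D" "prime_atom_monoid D'"
    and iso: "isomorphic (prime_atom_monoid.M D) (prime_atom_monoid.M D')"
  shows "D = D'"
proof -
  interpret A: prime_atom_monoid D by fact
  interpret B: prime_atom_monoid D' by fact
  have "1 \<in> A.M" using A.one_in_gens A.gens_subset_M by blast
  then obtain q where q: "q > 0" "B.M = (*) q ` A.M"
    using isomorphic_imp_scaling[OF A.puiseux_monoid_M B.puiseux_monoid_M iso] by blast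
  then have gens: "B.gens = (*) q ` A.gens"
    using atoms_scaling[of q A.M] A.atoms_M B.atoms_M by simp
  then have "q \<in> B.gens" using A.one_in_gens by force
  then have "q \<le> 1" by (rule B.gens_le_1)
  moreover have "q \<ge> 1"
  proof -
    obtain a where "a \<in> A.gens" "1 = q * a" using gens B.one_in_gens by auto
    then show ?thesis using A.gens_le_1[of a] q(1) by (metis mult_left_le less_imp_le)
  qed
  ultimately have "B.gens = A.gens" using gens by simp
  then have "B.gens - {1} = A.gens - {1}" by simp
  then have "prime_atom ` D' = prime_atom ` D"
    using A.prime_atom_neq_1 B.prime_atom_neq_1 by (auto simp: A.gens_def B.gens_def)
  then show ?thesis by (simp add: inj_image_eq_iff inj_def)
qed

theorem theorem4p5:
  shows "\<exists>M M'. puiseux_monoid M \<and> puiseux_monoid M' \<and>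
           \<not> finitely_generated M \<and> \<not> finitely_generated M' \<and>
           atomic M \<and> atomic M' \<and>
           \<not> isomorphic M M' \<and>
           system_of_sets_of_lengths M = system_of_sets_of_lengths M'"
proof -
  \<comment> \<open>The prime 2 has to go: 1/2 + 1/2 = 1 would prevent 1 from being an atom.\<close>
  define D where "D = {p::nat. prime p} - {2}"
  have inf: "infinite D" unfolding D_def using primes_infinite by simp
  have ge: "p \<ge> 3" if "p \<in> D" for p
    using that prime_ge_2_nat[of p] by (auto simp: D_def)
  have D: "prime_atom_monoid D"
    by unfold_locales (use inf ge in \<open>auto simp: D_def\<close>)
  \<comment> \<open>Any odd prime other than 3 could be dropped instead of 5; the exchange for 3
    must stay available.\<close>
  have D': "prime_atom_monoid (D - {5})"
    by unfold_locales (use inf ge in \<open>auto simp: D_def\<close>)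
  have "(5::nat) \<in> D" by (simp add: D_def)
  then have "\<not> isomorphic (prime_atom_monoid.M D) (prime_atom_monoid.M (D - {5}))"
    using prime_atom_monoid_isomorphic_imp_eq[OF D D'] by blast
  then show ?thesis
    using prime_atom_monoid.puiseux_monoid_M[OF D] prime_atom_monoid.puiseux_monoid_M[OF D']
      prime_atom_monoid.not_finitely_generated_M[OF D]
      prime_atom_monoid.not_finitely_generated_M[OF D']
      prime_atom_monoid.atomic_M[OF D] prime_atom_monoid.atomic_M[OF D']
      prime_atom_monoid.system_of_sets_of_lengths_M[OF D]
      prime_atom_monoid.system_of_sets_of_lengths_M[OF D']
    by metis
qed

end
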